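(* Every labelled sequent derivable in the calculus $\mathsf{G3Tstit}$ is valid.
   Context: Fix a finite set of agents $Ag=\{1,\dots,n\}$ and a countable set $Var$ of propositional variables. $\mathcal{L}_{\mathsf{Tstit}}$ (negation normal form): $\phi ::= p \mid \overline{p} \mid \phi\wedge\phi \mid \phi\vee\phi \mid \Box\phi \mid \Diamond\phi \mid [i]\phi \mid \langle i\rangle\phi \mid [Ag]\phi\mid\langle Ag\rangle\phi\mid \mathsf G\phi\mid\mathsf F\phi\mid\mathsf H\phi\mid\mathsf P\phi$, $p\in Var$, $i\in Ag$. A $\mathsf{Tstit}$-model is $(W,\mathcal{R}_\Box,\{\mathcal{R}_i\}_{i\in Ag},\mathcal{R}_{Ag},\mathcal{R}_{\mathsf G},\mathcal{R}_{\mathsf H},V)$ with $W\ne\emptyset$, $V:Var\to\mathcal P(W)$, $\mathcal{R}_\Box,\mathcal{R}_i,\mathcal{R}_{Ag}$ equivalence relations on $W$, and (writing $\mathcal R(w)=\{v:(w,v)\in\mathcal R\}$): (C1) $\mathcal{R}_i\subseteq\mathcal{R}_\Box$; (C2) if $u_1,\dots,u_n$ are pairwise $\mathcal R_\Box$-related then $\bigcap_i\mathcal{R}_i(u_i)\ne\emptyset$; (C3) $\mathcal{R}_{Ag}(w)=\bigcap_i\mathcal{R}_i(w)$; $\mathcal{R}_{\mathsf G}$ transitive and serial, $\mathcal{R}_{\mathsf H}$ its converse; (C4) if $\mathcal{R}_{\mathsf G}wu,\mathcal{R}_{\mathsf G}wv$ then $\mathcal{R}_{\mathsf G}uv$ or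 $u=v$ or $\mathcal{R}_{\mathsf G}vu$; (C5) same for $\mathcal{R}_{\mathsf H}$; (C6) $\mathcal{R}_{\mathsf G}\circ\mathcal{R}_\Box\subseteq\mathcal{R}_{Ag}\circ\mathcal{R}_{\mathsf G}$; (C7) $u\in\mathcal{R}_\Box(w)$ implies $u\notin\mathcal{R}_{\mathsf G}(w)$. Satisfaction: $w\models p$ iff $w\in V(p)$; $w\models\overline p$ iff $w\notin V(p)$; $\wedge,\vee$ classical; $\Box$/$\Diamond$, $[i]$/$\langle i\rangle$, $[Ag]$/$\langle Ag\rangle$, $\mathsf G$/$\mathsf F$, $\mathsf H$/$\mathsf P$ are universal/existential quantification over $\mathcal R_\Box(w)$, $\mathcal R_i(w)$, $\mathcal R_{Ag}(w)$, $\mathcal R_{\mathsf G}(w)$, $\mathcal R_{\mathsf H}(w)$ respectively. Labelled sequents of $\mathsf{G3Tstit}$: multisets of labelled formulas $x:\phi$ ($\phi\in\mathcal L_{\mathsf{Tstit}}$), relational atoms $\mathcal R_\alpha xy$ with $\mathcal R_\alpha\in\{\mathcal R_\Box,\mathcal R_i,\mathcal R_{Ag},\mathcal R_{\mathsf G},\breve{\mathcal R}_{\mathsf G},\mathcal R_{\mathsf H}\}$, and equalities $x=y$, labels from a countable set $L$. Rules (for any labels; "$v$ fresh" means $v$ does not occur in the conclusion): (id) $\Gamma,w:p,w:\overline p$ axiom; ($\wedge$) from $\Gamma,w:\phi$ and $\Gamma,w:\psi$ infer $\Gamma,w:\phi\wedge\psi$; ($\vee$) from $\Gamma,w:\phi,w:\psi$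 infer $\Gamma,w:\phi\vee\psi$; for each pair (box $\heartsuit$, diamond $\spadesuit$, relation $\mathcal R$) among ($\Box,\Diamond,\mathcal R_\Box$), ($[i],\langle i\rangle,\mathcal R_i$), ($[Ag],\langle Ag\rangle,\mathcal R_{Ag}$), ($\mathsf G,\mathsf F,\mathcal R_{\mathsf G}$), ($\mathsf H,\mathsf P,\mathcal R_{\mathsf H}$): from $\Gamma,\mathcal Rwv,v:\phi$ infer $\Gamma,w:\heartsuit\phi$ ($v$ fresh), and from $\Gamma,\mathcal Rwu,w:\spadesuit\phi,u:\phi$ infer $\Gamma,\mathcal Rwu,w:\spadesuit\phi$; ($\mathsf{refl}_\Box$), ($\mathsf{refl}_{[i]}$), ($\mathsf{refl}_{Ag}$), ($\mathsf{refl}_=$): from $\mathcal R_\Box ww,\Gamma$ (resp. $\mathcal R_iww,\Gamma$; $\mathcal R_{Ag}ww,\Gamma$; $w=w,\Gamma$) infer $\Gamma$; ($\mathsf{eucl}_\Box$), ($\mathsf{eucl}_{[i]}$), ($\mathsf{eucl}_{Ag}$), ($\mathsf{eucl}_=$): for $\mathcal R$ being $\mathcal R_\Box$, $\mathcal R_i$, $\mathcal R_{Ag}$, or equality, from $\mathcal Rwu,\mathcal Rwv,\mathcal Ruv,\Gamma$ infer $\mathcal Rwu,\mathcal Rwv,\Gamma$; ($\mathsf{IOA}$) from $\mathcal R_\Box wu_1,\dots,\mathcal R_\Box wu_n,\mathcal R_1u_1v,\dots,\mathcal R_nu_nv,\Gamma$ infer $\mathcal R_\Box wu_1,\dots,\mathcal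 R_\Box wu_n,\Gamma$ ($v$ fresh); ($\mathsf{br}_{[i]}$) from $\mathcal R_\Box wu,\mathcal R_iwu,\Gamma$ infer $\mathcal R_iwu,\Gamma$; ($\mathsf{agd}$) from $\mathcal R_{Ag}wu,\mathcal R_iwu,\Gamma$ infer $\mathcal R_{Ag}wu,\Gamma$; ($\mathsf{conv}_{\mathsf G}$) from $\mathcal R_{\mathsf G}wu,\mathcal R_{\mathsf H}uw,\Gamma$ infer $\mathcal R_{\mathsf G}wu,\Gamma$; ($\mathsf{conv}_{\mathsf H}$) from $\mathcal R_{\mathsf H}wu,\mathcal R_{\mathsf G}uw,\Gamma$ infer $\mathcal R_{\mathsf H}wu,\Gamma$; ($\mathsf{trans}_{\mathsf G}$) from $\mathcal R_{\mathsf G}wu,\mathcal R_{\mathsf G}uv,\mathcal R_{\mathsf G}wv,\Gamma$ infer $\mathcal R_{\mathsf G}wu,\mathcal R_{\mathsf G}uv,\Gamma$; ($\mathsf{ser}_{\mathsf G}$) from $\mathcal R_{\mathsf G}wv,\Gamma$ infer $\Gamma$ ($v$ fresh); ($\mathsf{conn}_{\mathsf G}$) from the three premises $\mathcal R_{\mathsf G}uv,\Delta$; $u=v,\Delta$; $\mathcal R_{\mathsf G}vu,\Delta$ with $\Delta=\mathcal R_{\mathsf G}wu,\mathcal R_{\mathsf G}wv,\Gamma$ infer $\Delta$; ($\mathsf{conn}_{\mathsf H}$) the same with $\mathcal R_{\mathsf H}$; ($\mathsf{ncuh}$) from $\mathcal R_{\mathsf G}wu,\mathcal R_\Box uz,\mathcal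 R_{Ag}wv,\mathcal R_{\mathsf G}vz,\Gamma$ infer $\mathcal R_{\mathsf G}wu,\mathcal R_\Box uz,\Gamma$ ($v$ fresh); ($\mathsf{irr}_{\mathsf G}$) from $\mathcal R_\Box wu,\breve{\mathcal R}_{\mathsf G}wu,\Gamma$ infer $\mathcal R_\Box wu,\Gamma$; ($\mathsf{comp}_{\mathsf G1}$) $\mathcal R_{\mathsf G}wu,\breve{\mathcal R}_{\mathsf G}wu,\Gamma$ is an axiom; ($\mathsf{comp}_{\mathsf G2}$) from $\mathcal R_{\mathsf G}wu,\Gamma$ and $\breve{\mathcal R}_{\mathsf G}wu,\Gamma$ infer $\Gamma$; ($\mathsf{sub}_=$) from $w=u,\Delta[w],\Delta[u],\Gamma$ infer $w=u,\Delta[w],\Gamma$, where $\Delta[w]$ is a multiset of relational atoms and labelled formulas and $\Delta[u]$ results from replacing all occurrences of $w$ by $u$. The calculus also contains, for each rule where a substitution of labels duplicates active relational atoms or equalities, the instance with the duplicates contracted. Interpretation: for a $\mathsf{Tstit}$-model $M$ and $I:L\to W$, $\breve{\mathcal R}_{\mathsf G}$ is interpreted as the complement of $\mathcal R_{\mathsf G}$ and $=$ as identity; $\Gamma$ is satisfied in $M$ under $I$ iff, whenever all relational atoms $\mathcal R_\alpha xy$ and equalities $x=y$ in $\Gamma$ hold of $I(x),I(y)$ in $M$, some $z:\phi$ in $\Gamma$ has $M,I(z)\models\phi$. $\Gamma$ is valid iff satisfied in every $\mathsf{Tstit}$-model under every $I$.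
   Formalization: In the rule ser_G the fresh label v is also required to differ from w; with v = w allowed (v not in Γ), comp_G1, irr_G, refl_Box and ser_G would derive the empty sequent, which is not valid. *)

theory Defs
  imports "HOL-Library.Multiset" "HOL-Library.Countable"
begin

section \<open>Language\<close>

text \<open>
  The set of agents $Ag = \{1, \dots, n\}$ is the universe of a finite type \<open>'ag\<close>.

  The five box/diamond pairs are indexed by \<open>modality\<close>: \<open>Settled\<close> stands for
  $\Box/\Diamond$, \<open>Agent i\<close> for $[i]/\langle i\rangle$, \<open>Grand\<close> for
  $[Ag]/\langle Ag\rangle$, \<open>Future\<close> for $G/F$ and \<open>Past\<close> for $H/P$.
\<close>

datatype 'ag modality = Settled | Agent 'ag | Grand | Future | Past

datatype ('p, 'ag) form =
    PosAtom 'p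
  | NegAtom 'p
  | Conj "('p, 'ag) form" "('p, 'ag) form"
  | Disj "('p, 'ag) form" "('p, 'ag) form"
  | Nec "'ag modality" "('p, 'ag) form"
  | Poss "'ag modality" "('p, 'ag) form"


section \<open>Models\<close>

record ('w, 'p, 'ag) tstit_structure =
  worlds :: "'w set"
  R_Box :: "'w rel"
  R_Agent :: "'ag \<Rightarrow> 'w rel"
  R_Ag :: "'w rel"
  R_G :: "'w rel"
  R_H :: "'w rel"
  valuation :: "'p \<Rightarrow> 'w set"

locale tstit_model =
  fixes M :: "('w, 'p, 'ag::finite) tstit_structure"
  assumes worlds_nonempty: "worlds M \<noteq> {}"
    and valuation_worlds: "\<And>p. valuation M p \<subseteq> worlds M"
    and equiv_Box: "equiv (worlds M) (R_Box M)"
    and equiv_Agent: "\<And>i. equiv (worlds M) (R_Agent M i)"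
    and equiv_Ag: "equiv (worlds M) (R_Ag M)"
    and C1: "\<And>i. R_Agent M i \<subseteq> R_Box M"
    and C2: "\<And>u. \<forall>i. u i \<in> worlds M \<Longrightarrow> \<forall>i j. (u i, u j) \<in> R_Box M \<Longrightarrow>
               (\<Inter>i. R_Agent M i `` {u i}) \<noteq> {}"
    and C3: "\<And>w. w \<in> worlds M \<Longrightarrow> R_Ag M `` {w} = (\<Inter>i. R_Agent M i `` {w})"
    and G_worlds: "R_G M \<subseteq> worlds M \<times> worlds M"
    and G_trans: "trans (R_G M)"
    and G_serial: "\<And>w. w \<in> worlds M \<Longrightarrow> \<exists>u. (w, u) \<in> R_G M"
    and H_converse: "R_H M = (R_G M)\<inverse>"
    and C4: "\<And>w u v. (w, u) \<in> R_G M \<Longrightarrow> (w, v) \<in> R_G M \<Longrightarrow>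
               (u, v) \<in> R_G M \<or> u = v \<or> (v, u) \<in> R_G M"
    and C5: "\<And>w u v. (w, u) \<in> R_H M \<Longrightarrow> (w, v) \<in> R_H M \<Longrightarrow>
               (u, v) \<in> R_H M \<or> u = v \<or> (v, u) \<in> R_H M"
    and C6: "R_G M O R_Box M \<subseteq> R_Ag M O R_G M"
    and C7: "\<And>w u. (w, u) \<in> R_Box M \<Longrightarrow> (w, u) \<notin> R_G M"

primrec acc :: "('w, 'p, 'ag) tstit_structure \<Rightarrow> 'ag modality \<Rightarrow> 'w rel" where
  "acc M Settled = R_Box M"
| "acc M (Agent i) = R_Agent M i"
| "acc M Grand = R_Ag M"
| "acc M Future = R_G M"
| "acc M Past = R_H M"

primrec sat :: "('w, 'p, 'ag) tstit_structure \<Rightarrow> 'w \<Rightarrow> ('p, 'ag) form \<Rightarrow> bool" where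
  "sat M w (PosAtom p) \<longleftrightarrow> w \<in> valuation M p"
| "sat M w (NegAtom p) \<longleftrightarrow> w \<notin> valuation M p"
| "sat M w (Conj \<phi> \<psi>) \<longleftrightarrow> sat M w \<phi> \<and> sat M w \<psi>"
| "sat M w (Disj \<phi> \<psi>) \<longleftrightarrow> sat M w \<phi> \<or> sat M w \<psi>"
| "sat M w (Nec m \<phi>) \<longleftrightarrow> (\<forall>v \<in> acc M m `` {w}. sat M v \<phi>)"
| "sat M w (Poss m \<phi>) \<longleftrightarrow> (\<exists>v \<in> acc M m `` {w}. sat M v \<phi>)"


section \<open>Labelled sequents\<close>

text \<open>\<open>NonG\<close> is the symbol $\breve{R}_G$.\<close>

datatype 'ag rel_symbol = Acc "'ag modality" | NonG

datatype (labels: 'l, dead 'p, dead 'ag) entry =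
    Labelled 'l "('p, 'ag) form"
  | Rel "'ag rel_symbol" 'l 'l
  | Eql 'l 'l
  for map: relabel

type_synonym ('l, 'p, 'ag) sequent = "('l, 'p, 'ag) entry multiset"

abbreviation sequent_labels :: "('l, 'p, 'ag) sequent \<Rightarrow> 'l set" where
  "sequent_labels \<Gamma> \<equiv> \<Union> (labels ` set_mset \<Gamma>)"

primrec rel_interp :: "('w, 'p, 'ag) tstit_structure \<Rightarrow> 'ag rel_symbol \<Rightarrow> 'w rel" where
  "rel_interp M (Acc m) = acc M m"
| "rel_interp M NonG = worlds M \<times> worlds M - R_G M"

definition satisfied ::
    "('w, 'p, 'ag) tstit_structure \<Rightarrow> ('l \<Rightarrow> 'w) \<Rightarrow> ('l, 'p, 'ag) sequent \<Rightarrow> bool" where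
  "satisfied M I \<Gamma> \<longleftrightarrow>
     (\<forall>\<alpha> x y. Rel \<alpha> x y \<in># \<Gamma> \<longrightarrow> (I x, I y) \<in> rel_interp M \<alpha>) \<and>
     (\<forall>x y. Eql x y \<in># \<Gamma> \<longrightarrow> I x = I y) \<longrightarrow>
     (\<exists>z \<phi>. Labelled z \<phi> \<in># \<Gamma> \<and> sat M (I z) \<phi>)"

text \<open>
  The type argument fixes the type from which worlds are drawn; validity in all models is
  \<open>valid\<close> for an arbitrary type \<open>'w\<close>.
\<close>

definition valid :: "'w itself \<Rightarrow> ('l, 'p, 'ag::finite) sequent \<Rightarrow> bool" where
  "valid _ \<Gamma> \<longleftrightarrow>
     (\<forall>(M :: ('w, 'p, 'ag) tstit_structure) I.
        tstit_model M \<longrightarrow> (\<forall>x. I x \<in> worlds M) \<longrightarrow> satisfied M I \<Gamma>)"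


section \<open>The calculus G3Tstit\<close>

text \<open>
  \<open>rule E Ps C\<close>: the rule instance with premises \<open>P + \<Gamma>\<close> for \<open>P\<close> in \<open>Ps\<close> and conclusion
  \<open>C + \<Gamma>\<close>, where the labels in \<open>E\<close> must be fresh. The context \<open>\<Gamma>\<close> is added in \<open>derivable\<close>
  below, so that only the active entries are displayed here. In \<open>ser_G\<close> the label \<open>w\<close> need not
  occur in the conclusion; as usual for eigenvariables, \<open>v\<close> is nevertheless distinct from it
  (with \<open>v = w\<close> the empty sequent would be derivable).
\<close>

inductive rule ::
    "'l set \<Rightarrow> ('l, 'p, 'ag::finite) sequent list \<Rightarrow> ('l, 'p, 'ag) sequent \<Rightarrow> bool" where
  ax_id: "rule {} [] {#Labelled w (PosAtom p), Labelled w (NegAtom p)#}"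
| conj: "rule {} [{#Labelled w \<phi>#}, {#Labelled w \<psi>#}] {#Labelled w (Conj \<phi> \<psi>)#}"
| disj: "rule {} [{#Labelled w \<phi>, Labelled w \<psi>#}] {#Labelled w (Disj \<phi> \<psi>)#}"
| nec: "rule {v} [{#Rel (Acc m) w v, Labelled v \<phi>#}] {#Labelled w (Nec m \<phi>)#}"
| poss: "rule {} [{#Rel (Acc m) w u, Labelled w (Poss m \<phi>), Labelled u \<phi>#}]
                 {#Rel (Acc m) w u, Labelled w (Poss m \<phi>)#}"
| refl: "m \<in> {Settled, Grand} \<union> range Agent \<Longrightarrow> rule {} [{#Rel (Acc m) w w#}] {#}"
| refl_eq: "rule {} [{#Eql w w#}] {#}"
| eucl: "m \<in> {Settled, Grand} \<union> range Agent \<Longrightarrow>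
    rule {} [{#Rel (Acc m) w u, Rel (Acc m) w v, Rel (Acc m) u v#}]
            {#Rel (Acc m) w u, Rel (Acc m) w v#}"
| eucl_eq: "rule {} [{#Eql w u, Eql w v, Eql u v#}] {#Eql w u, Eql w v#}"
| IOA: "rule {v}
    [{#Rel (Acc Settled) w (u i). i \<in># mset_set UNIV#} +
     {#Rel (Acc (Agent i)) (u i) v. i \<in># mset_set UNIV#}]
    {#Rel (Acc Settled) w (u i). i \<in># mset_set UNIV#}"
| br: "rule {} [{#Rel (Acc Settled) w u, Rel (Acc (Agent i)) w u#}]
               {#Rel (Acc (Agent i)) w u#}"
| agd: "rule {} [{#Rel (Acc Grand) w u, Rel (Acc (Agent i)) w u#}]
                {#Rel (Acc Grand) w u#}"
| conv_G: "rule {} [{#Rel (Acc Future) w u, Rel (Acc Past) u w#}] {#Rel (Acc Future) w u#}"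
| conv_H: "rule {} [{#Rel (Acc Past) w u, Rel (Acc Future) u w#}] {#Rel (Acc Past) w u#}"
| trans_G: "rule {}
    [{#Rel (Acc Future) w u, Rel (Acc Future) u v, Rel (Acc Future) w v#}]
    {#Rel (Acc Future) w u, Rel (Acc Future) u v#}"
| ser_G: "v \<noteq> w \<Longrightarrow> rule {v} [{#Rel (Acc Future) w v#}] {#}"
| conn: "m \<in> {Future, Past} \<Longrightarrow>
    rule {}
      [{#Rel (Acc m) u v, Rel (Acc m) w u, Rel (Acc m) w v#},
       {#Eql u v, Rel (Acc m) w u, Rel (Acc m) w v#},
       {#Rel (Acc m) v u, Rel (Acc m) w u, Rel (Acc m) w v#}]
      {#Rel (Acc m) w u, Rel (Acc m) w v#}"
| ncuh: "rule {v}
    [{#Rel (Acc Future) w u, Rel (Acc Settled) u z, Rel (Acc Grand) w v, Rel (Acc Future) v z#}]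
    {#Rel (Acc Future) w u, Rel (Acc Settled) u z#}"
| irr_G: "rule {} [{#Rel (Acc Settled) w u, Rel NonG w u#}] {#Rel (Acc Settled) w u#}"
| comp_G1: "rule {} [] {#Rel (Acc Future) w u, Rel NonG w u#}"
| comp_G2: "rule {} [{#Rel (Acc Future) w u#}, {#Rel NonG w u#}] {#}"
| sub_eq: "\<forall>x y. Eql x y \<notin># \<Delta> \<Longrightarrow>
    rule {} [{#Eql w u#} + \<Delta> + image_mset (relabel (id(w := u))) \<Delta>] ({#Eql w u#} + \<Delta>)"

text \<open>
  \<open>spare D N\<close>: \<open>D\<close> consists of superfluous copies of relational atoms and equalities of \<open>N\<close>.
  \<open>contracted Ps C Ps' C'\<close>: duplicates \<open>D\<close> among the active atoms of the conclusion are
  dropped from the conclusion and from all premises, and each premise may moreover drop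
  duplicates \<open>D'\<close> that only it contains. With nothing to drop this is the identity.
\<close>

definition spare :: "('l, 'p, 'ag) sequent \<Rightarrow> ('l, 'p, 'ag) sequent \<Rightarrow> bool" where
  "spare D N \<longleftrightarrow> set_mset D \<subseteq> set_mset N \<and> (\<forall>x \<phi>. Labelled x \<phi> \<notin># D)"

definition contracted ::
    "('l, 'p, 'ag) sequent list \<Rightarrow> ('l, 'p, 'ag) sequent \<Rightarrow>
     ('l, 'p, 'ag) sequent list \<Rightarrow> ('l, 'p, 'ag) sequent \<Rightarrow> bool" where
  "contracted Ps C Ps' C' \<longleftrightarrow>
     (\<exists>D. C = C' + D \<and> spare D C' \<and>
        list_all2 (\<lambda>P P'. \<exists>D'. P = P' + D + D' \<and> spare (D + D') P') Ps Ps')"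

inductive derivable :: "('l, 'p, 'ag::finite) sequent \<Rightarrow> bool" where
  step: "rule E Ps C \<Longrightarrow> contracted Ps C Ps' C' \<Longrightarrow> E \<inter> sequent_labels (C' + \<Gamma>) = {} \<Longrightarrow>
    \<forall>P \<in> set Ps'. derivable (P + \<Gamma>) \<Longrightarrow> derivable (C' + \<Gamma>)"

end

theory Submission
  imports Defs
begin

text \<open>
  A sequent reads as a disjunction in which relational atoms and equalities occur negated, so it
  fails to be satisfied exactly when each of its entries fails separately. Soundness is shown
  contrapositively: a refutation of the conclusion of a rule extends, by reassigning only the
  fresh labels, to a refutation of one of the premises. In this form contractions are harmless,
  since being refuted depends only on the set of entries.
\<close>

primrec entry_holds ::
    "('w, 'p, 'ag) tstit_structure \<Rightarrow> ('l \<Rightarrow> 'w) \<Rightarrow> ('l, 'p, 'ag) entry \<Rightarrow> bool" where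
  "entry_holds M I (Labelled z \<phi>) \<longleftrightarrow> sat M (I z) \<phi>"
| "entry_holds M I (Rel \<alpha> x y) \<longleftrightarrow> (I x, I y) \<notin> rel_interp M \<alpha>"
| "entry_holds M I (Eql x y) \<longleftrightarrow> I x \<noteq> I y"

definition refuted ::
    "('w, 'p, 'ag) tstit_structure \<Rightarrow> ('l \<Rightarrow> 'w) \<Rightarrow> ('l, 'p, 'ag) sequent \<Rightarrow> bool" where
  "refuted M I \<Gamma> \<longleftrightarrow> (\<forall>e \<in># \<Gamma>. \<not> entry_holds M I e)"

lemma refuted_empty [simp]: "refuted M I {#}"
  and refuted_add_mset [simp]:
    "refuted M I (add_mset e \<Gamma>) \<longleftrightarrow> \<not> entry_holds M I e \<and> refuted M I \<Gamma>"
  and refuted_union [simp]: "refuted M I (\<Gamma> + \<Delta>) \<longleftrightarrow> refuted M I \<Gamma> \<and> refuted M I \<Delta>"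
  and refuted_image_mset [simp]:
    "refuted M I (image_mset f A) \<longleftrightarrow> (\<forall>a \<in># A. \<not> entry_holds M I (f a))"
  by (auto simp: refuted_def)

text \<open>Brings a quantifier over entries into the shape of \<open>satisfied\<close>, which has a
  separate block for each kind of entry.\<close>

lemma all_entry_iff:
  "(\<forall>e. Q e) \<longleftrightarrow>
    (\<forall>z \<phi>. Q (Labelled z \<phi>)) \<and> (\<forall>\<alpha> x y. Q (Rel \<alpha> x y)) \<and> (\<forall>x y. Q (Eql x y))"
  by (metis entry.exhaust)

lemma satisfied_iff_not_refuted: "satisfied M I \<Gamma> \<longleftrightarrow> \<not> refuted M I \<Gamma>"
  unfolding satisfied_def refuted_def Ball_def all_entry_iff by simp blast

lemma entry_holds_relabel: "entry_holds M I (relabel f e) \<longleftrightarrow> entry_holds M (I \<circ> f) e"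
  by (cases e) auto

lemma entry_holds_cong:
  assumes "\<And>x. x \<in> labels e \<Longrightarrow> I x = J x"
  shows "entry_holds M I e \<longleftrightarrow> entry_holds M J e"
  using assms by (cases e) auto

lemma refuted_cong:
  assumes "\<And>x. x \<in> sequent_labels \<Gamma> \<Longrightarrow> I x = J x"
  shows "refuted M I \<Gamma> \<longleftrightarrow> refuted M J \<Gamma>"
  using assms entry_holds_cong[of _ I J M] unfolding refuted_def by blast

lemma set_mset_add_spare: "spare D N \<Longrightarrow> set_mset (N + D) = set_mset N"
  by (auto simp: spare_def)

text \<open>Whatever is dropped keeps a copy in what remains. Refutation depends only on the set of
  entries, so it passes between a rule instance and its contractions.\<close>

lemma contracted_set_mset:
  assumes "contracted Ps C Ps' C'"
  shows "set_mset C' = set_mset C"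
    and "P \<in> set Ps \<Longrightarrow> \<exists>P' \<in> set Ps'. set_mset P' = set_mset P"
proof -
  obtain D where C: "C = C' + D" "spare D C'"
    and Ps: "list_all2 (\<lambda>P P'. \<exists>D'. P = P' + D + D' \<and> spare (D + D') P') Ps Ps'"
    using assms unfolding contracted_def by blast
  show "set_mset C' = set_mset C"
    using C set_mset_add_spare by blast
  show "\<exists>P' \<in> set Ps'. set_mset P' = set_mset P" if P: "P \<in> set Ps"
  proof -
    obtain k where k: "k < length Ps" "P = Ps ! k"
      using P by (metis in_set_conv_nth)
    then obtain D' where "P = Ps' ! k + (D + D')" "spare (D + D') (Ps' ! k)"
      using list_all2_nthD[OF Ps] by (metis add.assoc)
    moreover have "Ps' ! k \<in> set Ps'"
      using k list_all2_lengthD[OF Ps] by simp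
    ultimately show ?thesis
      using set_mset_add_spare by blast
  qed
qed

context tstit_model
begin

lemma equiv_acc:
  "m \<in> {Settled, Grand} \<union> range Agent \<Longrightarrow> equiv (worlds M) (acc M m)"
  using equiv_Box equiv_Agent equiv_Ag by auto

lemma acc_worlds: "acc M m \<subseteq> worlds M \<times> worlds M"
proof (cases m)
  case Future
  then show ?thesis using G_worlds by simp
next
  case Past
  then show ?thesis using G_worlds H_converse by auto
next
  case Settled
  then show ?thesis using equiv_type[OF equiv_Box] by simp
next
  case Grand
  then show ?thesis using equiv_type[OF equiv_Ag] by simp
next
  case (Agent i)
  then show ?thesis using equiv_type[OF equiv_Agent[of i]] by simp
qed

lemma acc_refl:
  "m \<in> {Settled, Grand} \<union> range Agent \<Longrightarrow> w \<in> worlds M \<Longrightarrow> (w, w) \<in> acc M m"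
  using equiv_acc by (metis equiv_class_self Image_singleton_iff)

lemma acc_eucl:
  "m \<in> {Settled, Grand} \<union> range Agent \<Longrightarrow> (w, u) \<in> acc M m \<Longrightarrow> (w, v) \<in> acc M m \<Longrightarrow>
    (u, v) \<in> acc M m"
  using equiv_acc by (meson equivE symD transD)

lemma acc_conn:
  "m \<in> {Future, Past} \<Longrightarrow> (w, u) \<in> acc M m \<Longrightarrow> (w, v) \<in> acc M m \<Longrightarrow>
    (u, v) \<in> acc M m \<or> u = v \<or> (v, u) \<in> acc M m"
  using C4[of w u v] C5[of w u v] by auto

lemma Ag_imp_Agent: "(w, u) \<in> R_Ag M \<Longrightarrow> (w, u) \<in> R_Agent M i"
  using C3[of w] acc_worlds[of Grand] by auto

text \<open>\<open>C2\<close> wants the \<open>u i\<close> pairwise related, whereas the rule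
  \<open>IOA\<close> relates each of them to a common \<open>w\<close>; the Euclidean property of
  \<open>R_Box M\<close> bridges the two.\<close>

lemma independence_of_agents:
  assumes "\<And>i. (w, u i) \<in> R_Box M"
  shows "\<exists>v. \<forall>i. (u i, v) \<in> R_Agent M i"
proof -
  have "\<forall>i. u i \<in> worlds M"
    using assms acc_worlds[of Settled] by auto
  moreover have "\<forall>i j. (u i, u j) \<in> R_Box M"
    using acc_eucl[of Settled, OF _ assms[folded acc.simps(1)] assms[folded acc.simps(1)]] by simp
  ultimately have "(\<Inter>i. R_Agent M i `` {u i}) \<noteq> {}"
    by (rule C2)
  then show ?thesis by auto
qed

text \<open>Treats the active entries alone. Agreement of \<open>J\<close> with \<open>I\<close> off
  \<open>E\<close> later keeps the context refuted. For an axiom \<open>Ps\<close> is empty, so the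
  claim amounts to its conclusion being irrefutable.\<close>

lemma rule_refuted:
  assumes "rule E Ps C" and I: "\<And>x. I x \<in> worlds M"
    and "E \<inter> sequent_labels C = {}" and "refuted M I C"
  shows "\<exists>J. (\<forall>x. J x \<in> worlds M) \<and> (\<forall>x. x \<notin> E \<longrightarrow> J x = I x) \<and>
    (\<exists>P \<in> set Ps. refuted M J P)"
proof -
  have same: ?thesis if "\<exists>P \<in> set Ps. refuted M I P"
    using that I by blast
  \<comment> \<open>The new value \<open>a\<close> always arises as a successor of some
    \<open>b\<close>, which makes it a world.\<close>
  have reassign: ?thesis if "E = {v}" "(b, a) \<in> acc M m" "\<exists>P \<in> set Ps. refuted M (I(v := a)) P"
    for v a b m
    using that I acc_worlds[of m] by (intro exI[of _ "I(v := a)"]) auto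
  from assms(1) show ?thesis
  proof cases
    case (nec v m w \<phi>)
    then obtain a where "(I w, a) \<in> acc M m" "\<not> sat M a \<phi>"
      using assms(4) by auto
    then show ?thesis
      using nec assms(3) by (intro reassign[of v "I w" a m]) auto
  next
    case (IOA v w u)
    then obtain a where a: "(I (u i), a) \<in> acc M (Agent i)" for i
      using independence_of_agents[of "I w" "\<lambda>i. I (u i)"] assms(4) by auto
    \<comment> \<open>There is at least one agent, so \<open>w\<close> occurs in the conclusion and
      freshness applies to it too.\<close>
    have "v \<noteq> w" "v \<noteq> u i" for i
      using IOA(1,3) assms(3) by auto
    then show ?thesis
      using IOA assms(4) a by (intro reassign[of v, OF _ a]) auto
  next
    case (ser_G v w)
    \<comment> \<open>The label \<open>w\<close> need not occur anywhere, but \<open>I w\<close> is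
      still a world. The conclusion is empty, so \<open>v \<noteq> w\<close> comes from the side
      condition of the rule.\<close>
    obtain a where "(I w, a) \<in> acc M Future"
      using G_serial[OF I[of w]] by auto
    then show ?thesis
      using ser_G by (intro reassign[of v "I w" a Future]) auto
  next
    case (ncuh v w u z)
    then obtain a where a: "(I w, a) \<in> acc M Grand" "(a, I z) \<in> R_G M"
      using C6 assms(4) by auto
    then show ?thesis
      using ncuh assms(3,4) by (intro reassign[of v, OF _ a(1)]) auto
  next
    case (sub_eq \<Delta> w u)
    \<comment> \<open>Refuting the equality means \<open>I w = I u\<close>, so the relabelled copy
      of \<open>\<Delta>\<close> has the same truth values as \<open>\<Delta>\<close>.\<close>
    then have "I \<circ> id(w := u) = I"
      using assms(4) by auto
    then show ?thesis
      using sub_eq assms(4) by (intro same) (auto simp: refuted_def entry_holds_relabel)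
  next
    case (refl m w)
    then show ?thesis using acc_refl I by (intro same) auto
  next
    case (eucl m w u v)
    then show ?thesis using assms(4) acc_eucl[of m "I w" "I u" "I v"] by (intro same) auto
  next
    case (conn m u v w)
    then show ?thesis using assms(4) acc_conn[of m "I w" "I u" "I v"] by (intro same) auto
  next
    case (trans_G w u v)
    then show ?thesis using assms(4) transD[OF G_trans] by (intro same) auto
  next
    case (br w u i)
    then show ?thesis using assms(4) C1 by (intro same) auto
  next
    case (agd w u i)
    then show ?thesis using assms(4) Ag_imp_Agent[of _ _ i] by (intro same) auto
  next
    case (irr_G w u)
    then show ?thesis using assms(4) C7 I by (intro same) auto
  next
    case (conj w \<phi> \<psi>)
    then show ?thesis using assms(4) by (intro same) auto
  next
    case (comp_G2 w u)
    \<comment> \<open>Excluded middle for \<open>R_G M\<close>. As \<open>NonG\<close> is a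
      complement within the worlds, both labels must denote worlds.\<close>
    then show ?thesis using I by (intro same) auto
  \<comment> \<open>In the remaining cases the conclusion is an axiom and cannot be refuted, or
    \<open>I\<close> itself refutes the premise.\<close>
  qed (rule same, (use assms(4) in \<open>auto simp: H_converse\<close>)[1])+
qed

end

theorem theorem7:
  fixes \<Gamma> :: "('l::countable, 'p::countable, 'ag::finite) sequent"
  assumes "derivable \<Gamma>"
  shows "valid TYPE('w) \<Gamma>"
  unfolding valid_def satisfied_iff_not_refuted
proof (intro allI impI)
  fix M :: "('w, 'p, 'ag) tstit_structure" and I :: "'l \<Rightarrow> 'w"
  assume "tstit_model M" and "\<forall>x. I x \<in> worlds M"
  then interpret tstit_model M by simp
  from assms \<open>\<forall>x. I x \<in> worlds M\<close> show "\<not> refuted M I \<Gamma>"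
  \<comment> \<open>\<open>I\<close> varies because the induction hypothesis is applied to the
    reassigned \<open>J\<close>.\<close>
  proof (induction arbitrary: I)
    case (step E Ps C Ps' C' \<Gamma>)
    note contr = contracted_set_mset[OF step.hyps(2)]
    show ?case
    proof
      assume ref: "refuted M I (C' + \<Gamma>)"
      have "E \<inter> sequent_labels C = {}" "refuted M I C"
        using step.hyps(3) ref contr(1) by (auto simp: refuted_def)
      with step.hyps(1) step.prems obtain J P where P: "P \<in> set Ps" "refuted M J P"
        and J: "\<And>x. J x \<in> worlds M" "\<And>x. x \<notin> E \<Longrightarrow> J x = I x"
        by (metis rule_refuted)
      obtain P' where P': "P' \<in> set Ps'" "set_mset P' = set_mset P"
        using contr(2) P(1) by blast
      have "refuted M J P'"
        using P(2) P'(2) by (simp add: refuted_def)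
      \<comment> \<open>The labels in \<open>E\<close> are fresh for the context as well.\<close>
      moreover have "refuted M J \<Gamma> \<longleftrightarrow> refuted M I \<Gamma>"
        by (rule refuted_cong) (use J(2) step.hyps(3) in auto)
      ultimately have "refuted M J (P' + \<Gamma>)"
        using ref by simp
      then show False
        using step.IH P'(1) J(1) by blast
    qed
  qed
qed

end
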